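(* Let $f(x)=x_1^{\alpha_1}x_2^{\alpha_2}$ with real exponents $\alpha_1,\alpha_2>0$, and let $\Sigma$ be any positive semidefinite $2\times2$ matrix with positive diagonal entries. Then $$W_{f,\Sigma}\sim\frac{1}{(\alpha_1+\alpha_2)^2}\chi^2_1.$$
   Context: For a homogeneous polynomial $f\in\mathbb{R}[x_1,\dots,x_k]$ and a positive semidefinite $k\times k$ matrix $\Sigma=(\sigma_{ij})$, $W_{f,\Sigma}=f(X)^2/\big((\nabla f(X))^T\Sigma\nabla f(X)\big)$ with $X\sim\mathcal{N}_k(0,\Sigma)$. For $f(x)=x_1^{\alpha_1}x_2^{\alpha_2}$ with positive real (not necessarily integer) exponents, $W_{f,\Sigma}$ is understood in its simplified form $$W_{f,\Sigma}=\left(\sum_{i=1}^2\sum_{j=1}^2\sigma_{ij}\frac{\alpha_i\alpha_j}{X_iX_j}\right)^{-1},\qquad X=(X_1,X_2)^T\sim\mathcal{N}_2(0,\Sigma),$$ which agrees almost surely with the previous definition when the exponents are positive integers. $\chi^2_1$ is the chi-square distribution with one degree of freedom; $W\sim c\,\chi^2_1$ means that $W$ is distributed as $c$ times a $\chi^2_1$ random variable. *)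

theory Defs
  imports "HOL-Probability.Probability"
begin

definition positive_semidefinite :: "real ^ 'k ^ 'k \<Rightarrow> bool" where
  "positive_semidefinite S \<longleftrightarrow> transpose S = S \<and> (\<forall>v. 0 \<le> v \<bullet> (S *v v))"

text \<open>The law of a vector whose components are independent standard normal variables.\<close>

definition std_normal_vec :: "(real ^ 'k) measure" where
  "std_normal_vec = density lborel (\<lambda>z. ennreal (\<Prod>i\<in>UNIV. std_normal_density (z $ i)))"

text \<open>
  \<open>multivariate_normal N \<mu> S\<close> says that \<open>N\<close> is the law \<open>\<N>(\<mu>, S)\<close>: the law of \<open>\<mu> + A Z\<close> with
  \<open>Z\<close> a standard normal vector and \<open>A A\<^sup>T = S\<close>. This also covers singular \<open>S\<close>, for which there is
  no density. Every positive semidefinite \<open>S\<close> has a square factor \<open>A\<close>, and the law of \<open>\<mu> + A Z\<close>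
  does not depend on which one is taken.
\<close>

definition multivariate_normal :: "(real ^ 'k) measure \<Rightarrow> real ^ 'k \<Rightarrow> real ^ 'k ^ 'k \<Rightarrow> bool" where
  "multivariate_normal N \<mu> S \<longleftrightarrow>
     (\<exists>A :: real ^ 'k ^ 'k. A ** transpose A = S \<and>
        N = distr std_normal_vec borel (\<lambda>z. \<mu> + A *v z))"

text \<open>The chi-square law with \<open>n\<close> degrees of freedom: sum of squares of \<open>n\<close> independent standard
  normal variables.\<close>

definition chi_square :: "nat \<Rightarrow> real measure" where
  "chi_square n =
     distr (\<Pi>\<^sub>M i\<in>{..<n}. density lborel (\<lambda>x. ennreal (std_normal_density x))) borel
       (\<lambda>z. \<Sum>i<n. (z i)\<^sup>2)"

text \<open>
  The simplified form of \<open>f(x)\<^sup>2 / (\<nabla>f(x)\<^sup>T S \<nabla>f(x))\<close> for \<open>f(x) = \<Prod>\<^sub>i x\<^sub>i powr \<alpha>\<^sub>i\<close>, obtained from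
  \<open>\<partial>\<^sub>i f(x) = \<alpha>\<^sub>i f(x) / x\<^sub>i\<close>; it makes sense for vectors with negative components even when the
  exponents are not integers. Division by zero has value zero here, which only matters on the null
  event that some component of the random vector (or the sum itself) vanishes.
\<close>

definition W_monomial :: "real ^ 'k \<Rightarrow> real ^ 'k ^ 'k \<Rightarrow> real ^ 'k \<Rightarrow> real" where
  "W_monomial \<alpha> S x =
     inverse (\<Sum>i\<in>UNIV. \<Sum>j\<in>UNIV. S $ i $ j * (\<alpha> $ i * \<alpha> $ j / (x $ i * x $ j)))"

end

theory Submission
  imports Defs
begin

text \<open>
  Write \<open>a = \<alpha>\<^sub>1 + \<alpha>\<^sub>2\<close>. The standard normal law on the plane is invariant under rotations, so \<open>X\<close> has the
  law of \<open>(s Y\<^sub>1, c Y\<^sub>1 + d Y\<^sub>2)\<close> with \<open>Y\<^sub>1, Y\<^sub>2\<close> independent standard normal variables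
  (\<open>multivariate_normal_2_cholesky\<close>). If \<open>d = 0\<close>, then \<open>W = Y\<^sub>1\<^sup>2 / a\<^sup>2\<close> and there is nothing more to do.

  Otherwise let \<open>R\<^sup>2 = Y\<^sub>1\<^sup>2 + Y\<^sub>2\<^sup>2\<close>, \<open>T = Y\<^sub>2 / Y\<^sub>1\<close> and \<open>b = c / d\<close>. Algebra (\<open>W_monomial_regular\<close>) gives
  almost surely \<open>W = R\<^sup>2 / (a\<^sup>2 (1 + F(T)\<^sup>2))\<close>, where \<open>F(t) = p t + q (b t - 1) / (t + b)\<close> with the weights
  \<open>p = \<alpha>\<^sub>1 / a\<close> and \<open>q = \<alpha>\<^sub>2 / a\<close>. In terms of the angle of \<open>Y\<close>, \<open>F(T)\<close> is the weighted mean of the tangents of the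
  angles from the rows \<open>(s, 0)\<close> and \<open>(c, d)\<close> to \<open>Y\<close>.

  Two facts finish the proof. The variables \<open>R\<^sup>2\<close> and \<open>T\<close> are independent and \<open>T\<close> has the standard Cauchy
  law (\<open>nn_integral_std_normal_polar\<close>). The map \<open>F\<close> preserves the Cauchy law (\<open>distr_cauchy_inner\<close>):
  as a rational map it sends the upper half plane to itself and fixes the point \<open>i\<close>; the proof below
  computes distribution functions, the preimage of a half line being cut out by the two roots of
  a quadratic equation, whose arctangents add up correctly. Hence \<open>(R\<^sup>2, F(T))\<close> has the law of \<open>(R\<^sup>2, T)\<close>,
  and \<open>W\<close> has the law of \<open>R\<^sup>2 / (a\<^sup>2 (1 + T\<^sup>2)) = Y\<^sub>1\<^sup>2 / a\<^sup>2\<close>.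
\<close>

section \<open>Rotation invariance of the standard normal law\<close>

lemma lborel_orthogonal_transformation:
  fixes f :: "real ^ 'n::{finite,wellorder} \<Rightarrow> real ^ 'n::_"
  assumes "orthogonal_transformation f"
  shows "distr lborel borel f = lborel"
proof (rule lborel_eqI[symmetric])
  define g where "g = inv f"
  have g: "orthogonal_transformation g" and bij: "bij f"
    using assms by (auto simp: g_def orthogonal_transformation_inv orthogonal_transformation_bij)
  have [measurable]: "f \<in> borel_measurable borel"
    using assms by (intro borel_measurable_continuous_onI linear_continuous_on)
      (simp add: linear_linear orthogonal_transformation_linear)
  fix l u :: "real ^ 'n::_"
  assume lu: "\<And>b. b \<in> Basis \<Longrightarrow> l \<bullet> b \<le> u \<bullet> b"
  have img: "f -` box l u = g ` box l u"
    unfolding g_def using bij by (simp add: bij_vimage_eq_inv_image)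
  have box: "box l u \<in> lmeasurable" by simp
  have pre: "f -` box l u \<in> sets lborel"
    using measurable_sets[of f borel borel "box l u"] by simp
  have "emeasure (distr lborel borel f) (box l u) = emeasure lborel (f -` box l u)"
    by (simp add: emeasure_distr)
  also have "\<dots> = emeasure lebesgue (g ` box l u)"
    using pre by (simp add: img[symmetric])
  also have "\<dots> = emeasure lebesgue (box l u)"
    using measure_orthogonal_image[OF g box] measurable_orthogonal_image[OF g box] box
    by (simp add: emeasure_eq_measure2 fmeasurableD2)
  also have "\<dots> = (\<Prod>b\<in>Basis. (u - l) \<bullet> b)"
    using lu by (simp add: emeasure_lborel_box)
  finally show "emeasure (distr lborel borel f) (box l u) = (\<Prod>b\<in>Basis. (u - l) \<bullet> b)" .
qed simp

lemma prod_std_normal_density: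
  fixes z :: "real ^ 'n"
  shows "(\<Prod>i\<in>UNIV. std_normal_density (z $ i)) =
    (1 / sqrt (2 * pi)) ^ CARD('n) * exp (- (norm z)\<^sup>2 / 2)"
proof -
  have "(\<Sum>i\<in>UNIV. - (z $ i)\<^sup>2 / 2) = - (norm z)\<^sup>2 / 2"
    unfolding dot_square_norm[symmetric] inner_vec_def
    by (simp add: power2_eq_square sum_negf sum_divide_distrib)
  then show ?thesis
    unfolding std_normal_density_def prod.distrib by (simp add: exp_sum[symmetric])
qed

lemma std_normal_vec_orthogonal_transformation:
  fixes f :: "real ^ 'n::{finite,wellorder} \<Rightarrow> real ^ 'n::_"
  assumes "orthogonal_transformation f"
  shows "distr std_normal_vec borel f = std_normal_vec"
proof -
  let ?d = "\<lambda>z :: real ^ 'n::_. ennreal (\<Prod>i\<in>UNIV. std_normal_density (z $ i))"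
  have [measurable]: "f \<in> borel_measurable borel"
    using assms by (intro borel_measurable_continuous_onI linear_continuous_on)
      (simp add: linear_linear orthogonal_transformation_linear)
  have [measurable]: "?d \<in> borel_measurable borel"
    unfolding prod_std_normal_density by measurable
  have "?d (f z) = ?d z" for z
    using assms by (simp add: prod_std_normal_density orthogonal_transformation_norm)
  then have "distr (density lborel ?d) borel f = density (distr lborel borel f) ?d"
    by (subst density_distr) simp_all
  then show ?thesis
    by (simp add: std_normal_vec_def lborel_orthogonal_transformation[OF assms])
qed

text \<open>The standard normal law on the real line.\<close>

abbreviation std_normal :: "real measure" where
  "std_normal \<equiv> density lborel (\<lambda>x. ennreal (std_normal_density x))"

lemma prob_space_std_normal: "prob_space std_normal"
  by (simp add: prob_space_normal_density)

lemma measurable_vector_2 [measurable (raw)]: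
  fixes f g :: "'a \<Rightarrow> real"
  assumes [measurable]: "f \<in> borel_measurable M" "g \<in> borel_measurable M"
  shows "(\<lambda>x. vector [f x, g x] :: real ^ 2) \<in> borel_measurable M"
proof -
  have "(vector [f x, g x] :: real ^ 2) = f x *\<^sub>R axis 1 1 + g x *\<^sub>R axis 2 1" for x
    by (simp add: vec_eq_iff forall_2 axis_def)
  then show ?thesis by simp
qed

lemma measurable_vec_nth [measurable (raw)]:
  fixes f :: "'a \<Rightarrow> real ^ 'n"
  assumes "f \<in> borel_measurable M"
  shows "(\<lambda>x. f x $ i) \<in> borel_measurable M"
proof -
  have "(\<lambda>z :: real ^ 'n. z $ i) \<in> borel_measurable borel"
    by (intro borel_measurable_continuous_onI continuous_intros)
  from measurable_compose[OF assms this] show ?thesis .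
qed

lemma lborel_vec_2:
  "distr (lborel \<Otimes>\<^sub>M lborel) borel (\<lambda>(x, y). vector [x, y] :: real ^ 2) = lborel"
proof (rule lborel_eqI[symmetric])
  fix l u :: "real ^ 2"
  assume lu: "\<And>b. b \<in> Basis \<Longrightarrow> l \<bullet> b \<le> u \<bullet> b"
  have le: "l $ i \<le> u $ i" for i
    using lu[of "axis i 1"] by (simp add: inner_axis axis_in_Basis_iff)
  have B: "(Basis :: (real ^ 2) set) = {axis 1 1, axis 2 1}"
    by (auto simp: Basis_vec_def UNIV_2)
  have pre: "(\<lambda>(x, y). vector [x, y] :: real ^ 2) -` box l u = box (l $ 1) (u $ 1) \<times> box (l $ 2) (u $ 2)"
    by (auto simp: box_def B inner_axis)
  have "emeasure (distr (lborel \<Otimes>\<^sub>M lborel) borel (\<lambda>(x, y). vector [x, y] :: real ^ 2)) (box l u) =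
      emeasure (lborel \<Otimes>\<^sub>M lborel) (box (l $ 1) (u $ 1) \<times> box (l $ 2) (u $ 2))"
    by (subst emeasure_distr) (auto simp: pre space_pair_measure)
  also have "\<dots> = (\<Prod>b\<in>Basis. (u - l) \<bullet> b)"
    using le by (subst lborel.emeasure_pair_measure_Times)
      (auto simp: B axis_eq_axis inner_axis ennreal_mult')
  finally show "emeasure (distr (lborel \<Otimes>\<^sub>M lborel) borel (\<lambda>(x, y). vector [x, y] :: real ^ 2)) (box l u)
     = (\<Prod>b\<in>Basis. (u - l) \<bullet> b)" .
qed simp

lemma std_normal_vec_2:
  "std_normal_vec = distr (std_normal \<Otimes>\<^sub>M std_normal) borel (\<lambda>(x, y). vector [x, y] :: real ^ 2)"
proof -
  interpret prob_space std_normal by (rule prob_space_std_normal)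
  have "std_normal \<Otimes>\<^sub>M std_normal = density (lborel \<Otimes>\<^sub>M lborel)
      (\<lambda>(x, y). ennreal (std_normal_density x) * ennreal (std_normal_density y))"
    by (intro pair_measure_density) (auto intro: sigma_finite_lborel sigma_finite_measure_axioms)
  moreover have "std_normal_vec = density (distr (lborel \<Otimes>\<^sub>M lborel) borel (\<lambda>(x, y). vector [x, y] :: real ^ 2))
     (\<lambda>z. ennreal (\<Prod>i\<in>UNIV. std_normal_density (z $ i)))"
    by (simp add: lborel_vec_2 std_normal_vec_def)
  ultimately show ?thesis
    by (simp add: density_distr case_prod_unfold prod_2 UNIV_2 ennreal_mult')
qed

section \<open>The Cauchy law and maps that preserve it\<close>

text \<open>The standard Cauchy law on the real line.\<close>

definition cauchy :: "real measure" where
  "cauchy = density lborel (\<lambda>t. ennreal (1 / (pi * (1 + t\<^sup>2))))"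

lemma space_cauchy [simp]: "space cauchy = UNIV"
  and sets_cauchy [simp, measurable_cong]: "sets cauchy = sets borel"
  by (simp_all add: cauchy_def)

lemma emeasure_cauchy_atMost: "emeasure cauchy {..x} = ennreal (1 / 2 + arctan x / pi)"
proof -
  have "emeasure cauchy {..x} = (\<integral>\<^sup>+t. ennreal (1 / (pi * (1 + t\<^sup>2))) * indicator {..x} t \<partial>lborel)"
    unfolding cauchy_def by (subst emeasure_density) auto
  also have "\<dots> = (\<integral>\<^sup>+t. ennreal (1 / (pi * (1 + t\<^sup>2))) * indicator {- x..} t \<partial>lborel)"
    by (subst nn_integral_real_affine[where c = "- 1" and t = 0])
      (auto intro!: nn_integral_cong split: split_indicator)
  also have "\<dots> = ennreal (pi / 2 / pi - arctan (- x) / pi)"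
  proof (rule nn_integral_FTC_atLeast)
    fix t :: real
    show "((\<lambda>t. arctan t / pi) has_field_derivative 1 / (pi * (1 + t\<^sup>2))) (at t)"
      using DERIV_cdivide[OF DERIV_arctan[of t], of pi] by (simp add: divide_inverse mult.commute)
    show "((\<lambda>t. arctan t / pi) \<longlongrightarrow> pi / 2 / pi) at_top"
      by (intro tendsto_divide tendsto_arctan_at_top tendsto_const) simp
  qed auto
  finally show ?thesis by (simp add: arctan_minus)
qed

lemma real_distribution_cauchy: "real_distribution cauchy"
proof -
  have "(\<lambda>n. emeasure cauchy {..real n}) \<longlonglongrightarrow> emeasure cauchy (\<Union>n. {..real n})"
    by (intro Lim_emeasure_incseq) (auto simp: incseq_def)
  also have "(\<Union>n. {..real n}) = UNIV"
    by (auto intro: real_arch_simple)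
  finally have "(\<lambda>n. ennreal (1 / 2 + arctan (real n) / pi)) \<longlonglongrightarrow> emeasure cauchy UNIV"
    by (simp add: emeasure_cauchy_atMost)
  moreover have "(\<lambda>n. ennreal (1 / 2 + arctan (real n) / pi)) \<longlonglongrightarrow> ennreal (1 / 2 + (pi / 2) / pi)"
    by (intro tendsto_ennrealI tendsto_intros filterlim_compose[OF tendsto_arctan_at_top]
        filterlim_real_sequentially) simp
  ultimately have "emeasure cauchy UNIV = 1"
    by (auto dest: LIMSEQ_unique)
  then have "prob_space cauchy" by (intro prob_spaceI) simp
  then show ?thesis
    by (simp add: real_distribution_def real_distribution_axioms_def)
qed

lemma cdf_cauchy: "cdf cauchy x = 1 / 2 + arctan x / pi"
proof -
  have "arctan x / pi \<ge> - (pi / 2) / pi"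
    using arctan_lbound[of x] by (intro divide_right_mono) auto
  then show ?thesis
    by (simp add: cdf_def measure_def emeasure_cauchy_atMost)
qed

text \<open>
  The hypothesis on products is the equality of the tangents of \<open>arctan s + arctan t\<close> and
  \<open>arctan x - arctan b\<close>, cleared of denominators. The position of \<open>- b\<close> between \<open>s\<close> and \<open>t\<close> excludes
  a difference by a nonzero multiple of \<open>pi\<close>.
\<close>

lemma arctan_add_add_eq:
  fixes b x s t :: real
  assumes "s < - b" "- b < t" and tan: "(s + t) * (1 + x * b) = (x - b) * (1 - s * t)"
  shows "arctan s + arctan t + arctan b = arctan x"
proof -
  let ?d = "arctan s + arctan t + arctan b - arctan x"
  let ?C = "cos (arctan s) * cos (arctan t) * cos (arctan b) * cos (arctan x)"
  have sin: "sin (arctan y) = y * cos (arctan y)" for y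
    using tan_arctan[of y] cos_arctan_not_zero[of y] by (simp add: tan_def field_simps)
  have "sin ?d = ?C * ((s + t) * (1 + x * b) - (x - b) * (1 - s * t))"
    unfolding sin_add sin_diff cos_add cos_diff sin by (simp add: algebra_simps)
  then have "sin ?d = 0" using tan by simp
  moreover have "arctan s < - arctan b" "- arctan b < arctan t"
    using assms(1,2) by (simp_all flip: arctan_minus add: arctan_less_iff)
  then have "- pi < ?d" "?d < pi"
    using arctan_bounded[of s] arctan_bounded[of t] arctan_bounded[of x] by linarith+
  ultimately show ?thesis
    using sin_eq_0_pi by force
qed

text \<open>
  The map, called \<open>F\<close> here, increases from \<open>-\<infinity>\<close> to \<open>\<infinity>\<close> on each side of its pole \<open>- b\<close>, so \<open>F(y) \<le> x\<close> holds on a half line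
  up to \<open>s\<close> and on an interval from the pole to \<open>t\<close>, where \<open>s\<close> and \<open>t\<close> solve \<open>F(y) = x\<close>. The value
  at the pole itself, set by division by zero, does not matter.
\<close>

lemma distr_cauchy_inner:
  fixes p q b :: real
  assumes p: "0 < p" and q: "0 < q" and pq: "p + q = 1"
  shows "distr cauchy borel (\<lambda>t. p * t + q * (b * t - 1) / (t + b)) = cauchy" (is "distr _ _ ?F = _")
proof (rule cdf_unique)
  interpret real_distribution cauchy by (rule real_distribution_cauchy)
  show "real_distribution (distr cauchy borel ?F)"
    by (intro real_distribution_distr) simp
  show "real_distribution cauchy" by (rule real_distribution_cauchy)
  show "cdf (distr cauchy borel ?F) = cdf cauchy"
  proof
    fix x
    \<comment> \<open>Clearing denominators in \<open>F(y) = x\<close> gives \<open>p y\<^sup>2 - (x - b) y - (x b + q) = 0\<close>, of discriminant \<open>D\<close>.\<close>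
    define D where "D = (x - b)\<^sup>2 + 4 * p * (x * b + q)"
    define s where "s = ((x - b) - sqrt D) / (2 * p)"
    define t where "t = ((x - b) + sqrt D) / (2 * p)"
    have "D = (2 * p * b + (x - b))\<^sup>2 + 4 * p * q * (1 + b\<^sup>2)"
    proof -
      have q_eq: "q = 1 - p" using pq by simp
      show ?thesis unfolding D_def q_eq by (simp add: power2_eq_square algebra_simps)
    qed
    moreover have "4 * p * q * (1 + b\<^sup>2) > 0"
      using p q by (simp add: add_pos_nonneg)
    ultimately have D: "(2 * p * b + (x - b))\<^sup>2 < D" by simp
    then have D0: "0 \<le> D" by (smt (verit) zero_le_power2)
    have "\<bar>2 * p * b + (x - b)\<bar> < sqrt D"
      using D by (intro real_less_rsqrt) simp
    then have st: "s < - b" "- b < t"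
      using p unfolding s_def t_def by (simp_all add: field_simps)
    have sum: "p * (s + t) = x - b"
      using p by (simp add: s_def t_def field_simps)
    have "p * (s * t) = ((x - b)\<^sup>2 - (sqrt D)\<^sup>2) / (4 * p)"
      using p by (simp add: s_def t_def field_simps power2_eq_square)
    also have "\<dots> = - (x * b + q)"
      using p D0 by (simp add: D_def)
    finally have prod: "p * (s * t) = - (x * b + q)" .
    have "p * ((s + t) * (1 + x * b)) = p * ((x - b) * (1 - s * t))"
    proof -
      have "p * ((s + t) * (1 + x * b)) = (x - b) * (1 + x * b)"
        by (simp add: sum flip: mult.assoc)
      also have "\<dots> = (x - b) * (p - p * (s * t))"
        using pq by (simp add: prod)
      finally show ?thesis by (simp add: algebra_simps)
    qed
    then have arc: "arctan s + arctan t + arctan b = arctan x"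
      using p st by (intro arctan_add_add_eq) auto
    have F: "?F y \<le> x \<longleftrightarrow> y \<le> s \<or> - b < y \<and> y \<le> t" if "y \<noteq> - b" for y
    proof -
      have nz: "y + b \<noteq> 0" using that by simp
      have "p * ((y - s) * (y - t)) = p * y\<^sup>2 - (p * (s + t)) * y + p * (s * t)"
        by (simp add: power2_eq_square algebra_simps)
      also have "\<dots> = p * y\<^sup>2 - (x - b) * y - (x * b + q)"
        by (simp add: sum prod)
      also have "\<dots> = (?F y - x) * (y + b)"
      proof -
        have "(?F y - x) * (y + b) = p * y * (y + b) + q * (b * y - 1) - x * (y + b)"
          using nz by (simp add: distrib_right left_diff_distrib)
        also have "\<dots> = p * y\<^sup>2 + (p + q) * b * y - x * y - (x * b + q)"
          by (simp add: power2_eq_square algebra_simps)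
        finally show ?thesis using pq by (simp add: algebra_simps)
      qed
      finally have eq: "(?F y - x) * (y + b) = p * ((y - s) * (y - t))" ..
      have "?F y \<le> x \<longleftrightarrow> (if 0 < y + b then (?F y - x) * (y + b) \<le> 0 else 0 \<le> (?F y - x) * (y + b))"
        using nz by (auto simp: mult_le_0_iff zero_le_mult_iff)
      also have "\<dots> \<longleftrightarrow> y \<le> s \<or> - b < y \<and> y \<le> t"
        unfolding eq using st p nz by (auto simp: mult_le_0_iff zero_le_mult_iff)
      finally show ?thesis .
    qed
    have "AE y in cauchy. y \<noteq> - b"
      unfolding cauchy_def by (subst AE_density) (use AE_lborel_singleton[of "- b"] in auto)
    then have "measure cauchy {y. ?F y \<le> x} = measure cauchy ({..s} \<union> {- b<..t})"
      by (intro measure_eq_AE) (auto simp: F)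
    also have "\<dots> = measure cauchy {..s} + measure cauchy {- b<..t}"
      using st by (intro finite_measure_Union) auto
    also have "\<dots> = cdf cauchy s + (cdf cauchy t - cdf cauchy (- b))"
      using cdf_diff_eq[of "- b" t] st by (simp add: cdf_def)
    also have "\<dots> = cdf cauchy x"
      unfolding cdf_cauchy arc[symmetric] by (simp add: arctan_minus add_divide_distrib)
    finally show "cdf (distr cauchy borel ?F) x = cdf cauchy x"
      by (simp add: cdf_def measure_distr vimage_def)
  qed
qed

section \<open>Radius and slope of a standard normal vector\<close>

text \<open>
  Under the standard normal law of \<open>(x, y)\<close>, the variables \<open>x\<^sup>2 + y\<^sup>2\<close> and \<open>y / x\<close> are independent, and
  \<open>y / x\<close> is Cauchy. The first variable is represented as \<open>r\<^sup>2\<close> with \<open>r\<close> of density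
  \<open>\<bar>r\<bar> exp (- r\<^sup>2 / 2) / 2\<close> on the whole line, which avoids restricting to \<open>x > 0\<close>.
  The proof substitutes \<open>y = x t\<close>, exchanges the integrals and then rescales \<open>x = r / sqrt (1 + t\<^sup>2)\<close>.
\<close>

lemma nn_integral_std_normal_polar:
  fixes k :: "real \<times> real \<Rightarrow> ennreal"
  assumes [measurable]: "k \<in> borel_measurable (borel \<Otimes>\<^sub>M borel)"
  shows "(\<integral>\<^sup>+(x, y). k (x\<^sup>2 + y\<^sup>2, y / x) \<partial>(std_normal \<Otimes>\<^sub>M std_normal)) =
    (\<integral>\<^sup>+t. (\<integral>\<^sup>+r. ennreal (\<bar>r\<bar> / 2 * exp (- r\<^sup>2 / 2)) * k (r\<^sup>2, t) \<partial>lborel) \<partial>cauchy)"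
proof -
  interpret N: prob_space std_normal by (rule prob_space_std_normal)
  let ?n = std_normal_density
  let ?e = "\<lambda>x t. ennreal (\<bar>x\<bar> / (2 * pi) * exp (- (x\<^sup>2 * (1 + t\<^sup>2)) / 2))"
  have dens: "?n x * (\<bar>x\<bar> * ?n (x * t)) = \<bar>x\<bar> / (2 * pi) * exp (- (x\<^sup>2 * (1 + t\<^sup>2)) / 2)" for x t
    by (simp add: std_normal_density_def exp_add[symmetric] real_sqrt_mult field_simps)
  have slice: "ennreal (?n x) * (\<integral>\<^sup>+y. ennreal (?n y) * k (x\<^sup>2 + y\<^sup>2, y / x) \<partial>lborel) =
      (\<integral>\<^sup>+t. ?e x t * k (x\<^sup>2 * (1 + t\<^sup>2), t) \<partial>lborel)" if "x \<noteq> 0" for x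
  proof -
    have "(\<integral>\<^sup>+y. ennreal (?n y) * k (x\<^sup>2 + y\<^sup>2, y / x) \<partial>lborel) =
        ennreal \<bar>x\<bar> * (\<integral>\<^sup>+t. ennreal (?n (x * t)) * k (x\<^sup>2 * (1 + t\<^sup>2), t) \<partial>lborel)"
      using that
      by (subst nn_integral_real_affine[where c = x and t = 0]) (auto simp: power_mult_distrib distrib_left)
    then show ?thesis
      unfolding dens[symmetric] by (simp add: ennreal_mult mult.assoc nn_integral_cmult)
  qed
  have radial: "(\<integral>\<^sup>+x. ?e x t * k (x\<^sup>2 * (1 + t\<^sup>2), t) \<partial>lborel) =
      ennreal (1 / (pi * (1 + t\<^sup>2))) * (\<integral>\<^sup>+r. ennreal (\<bar>r\<bar> / 2 * exp (- r\<^sup>2 / 2)) * k (r\<^sup>2, t) \<partial>lborel)" for t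
  proof -
    define c where "c = 1 / sqrt (1 + t\<^sup>2)"
    have pos: "0 < 1 + t\<^sup>2" by (simp add: add_pos_nonneg)
    then have c: "0 < c" and c2: "c\<^sup>2 * (1 + t\<^sup>2) = 1"
      by (simp_all add: c_def power_divide)
    have sq: "(c * r)\<^sup>2 * (1 + t\<^sup>2) = r\<^sup>2" for r
      using c2 by (simp add: power_mult_distrib mult.commute mult.left_commute)
    have "c * (\<bar>c * r\<bar> / (2 * pi) * exp (- r\<^sup>2 / 2)) = c\<^sup>2 / pi * (\<bar>r\<bar> / 2 * exp (- r\<^sup>2 / 2))" for r
      using c by (simp add: abs_mult power2_eq_square)
    moreover have "c\<^sup>2 / pi = 1 / (pi * (1 + t\<^sup>2))"
      using pos by (simp add: c_def power_divide)
    ultimately have e: "c * (\<bar>c * r\<bar> / (2 * pi) * exp (- r\<^sup>2 / 2)) =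
        1 / (pi * (1 + t\<^sup>2)) * (\<bar>r\<bar> / 2 * exp (- r\<^sup>2 / 2))" for r
      by simp
    have "(\<integral>\<^sup>+x. ?e x t * k (x\<^sup>2 * (1 + t\<^sup>2), t) \<partial>lborel) =
        ennreal c * (\<integral>\<^sup>+r. ?e (c * r) t * k (r\<^sup>2, t) \<partial>lborel)"
      using c by (subst nn_integral_real_affine[where c = c and t = 0]) (auto simp: sq)
    also have "\<dots> = (\<integral>\<^sup>+r. ennreal c * (?e (c * r) t * k (r\<^sup>2, t)) \<partial>lborel)"
      by (simp add: nn_integral_cmult)
    also have "\<dots> = (\<integral>\<^sup>+r. ennreal (1 / (pi * (1 + t\<^sup>2))) *
        (ennreal (\<bar>r\<bar> / 2 * exp (- r\<^sup>2 / 2)) * k (r\<^sup>2, t)) \<partial>lborel)"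
    proof (rule nn_integral_cong)
      fix r
      have "ennreal c * ?e (c * r) t = ennreal (c * (\<bar>c * r\<bar> / (2 * pi) * exp (- r\<^sup>2 / 2)))"
        unfolding sq using c by (intro ennreal_mult[symmetric]) auto
      also have "\<dots> = ennreal (1 / (pi * (1 + t\<^sup>2))) * ennreal (\<bar>r\<bar> / 2 * exp (- r\<^sup>2 / 2))"
        unfolding e using pos by (intro ennreal_mult) auto
      finally show "ennreal c * (?e (c * r) t * k (r\<^sup>2, t)) =
          ennreal (1 / (pi * (1 + t\<^sup>2))) * (ennreal (\<bar>r\<bar> / 2 * exp (- r\<^sup>2 / 2)) * k (r\<^sup>2, t))"
        by (simp only: mult.assoc[symmetric])
    qed
    finally show ?thesis by (simp add: nn_integral_cmult)
  qed
  have "(\<integral>\<^sup>+(x, y). k (x\<^sup>2 + y\<^sup>2, y / x) \<partial>(std_normal \<Otimes>\<^sub>M std_normal)) =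
      (\<integral>\<^sup>+x. (\<integral>\<^sup>+y. k (x\<^sup>2 + y\<^sup>2, y / x) \<partial>std_normal) \<partial>std_normal)"
    by (subst N.nn_integral_fst[symmetric]) auto
  also have "\<dots> = (\<integral>\<^sup>+x. ennreal (?n x) * (\<integral>\<^sup>+y. ennreal (?n y) * k (x\<^sup>2 + y\<^sup>2, y / x) \<partial>lborel) \<partial>lborel)"
    by (simp add: nn_integral_density)
  also have "\<dots> = (\<integral>\<^sup>+x. (\<integral>\<^sup>+t. ?e x t * k (x\<^sup>2 * (1 + t\<^sup>2), t) \<partial>lborel) \<partial>lborel)"
    using AE_lborel_singleton[of "0 :: real"]
    by (intro nn_integral_cong_AE) (auto simp: slice elim!: eventually_mono)
  also have "\<dots> = (\<integral>\<^sup>+t. (\<integral>\<^sup>+x. ?e x t * k (x\<^sup>2 * (1 + t\<^sup>2), t) \<partial>lborel) \<partial>lborel)"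
    by (rule lborel_pair.Fubini'[symmetric]) simp
  also have "\<dots> = (\<integral>\<^sup>+t. (\<integral>\<^sup>+r. ennreal (\<bar>r\<bar> / 2 * exp (- r\<^sup>2 / 2)) * k (r\<^sup>2, t) \<partial>lborel) \<partial>cauchy)"
    unfolding radial cauchy_def by (subst nn_integral_density) auto
  finally show ?thesis .
qed

lemma nn_integral_std_normal_cauchy_map:
  fixes k :: "real \<times> real \<Rightarrow> ennreal"
  assumes [measurable]: "k \<in> borel_measurable (borel \<Otimes>\<^sub>M borel)" "F \<in> borel_measurable borel"
    and F: "distr cauchy borel F = cauchy"
  shows "(\<integral>\<^sup>+(x, y). k (x\<^sup>2 + y\<^sup>2, F (y / x)) \<partial>(std_normal \<Otimes>\<^sub>M std_normal)) =
    (\<integral>\<^sup>+(x, y). k (x\<^sup>2 + y\<^sup>2, y / x) \<partial>(std_normal \<Otimes>\<^sub>M std_normal))"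
proof -
  let ?G = "\<lambda>t. \<integral>\<^sup>+r. ennreal (\<bar>r\<bar> / 2 * exp (- r\<^sup>2 / 2)) * k (r\<^sup>2, t) \<partial>lborel"
  have "(\<integral>\<^sup>+(x, y). k (x\<^sup>2 + y\<^sup>2, F (y / x)) \<partial>(std_normal \<Otimes>\<^sub>M std_normal)) = (\<integral>\<^sup>+t. ?G (F t) \<partial>cauchy)"
    using nn_integral_std_normal_polar[of "\<lambda>(s, t). k (s, F t)"] by simp
  also have "\<dots> = (\<integral>\<^sup>+t. ?G t \<partial>distr cauchy borel F)"
    by (subst nn_integral_distr) auto
  also have "\<dots> = (\<integral>\<^sup>+(x, y). k (x\<^sup>2 + y\<^sup>2, y / x) \<partial>(std_normal \<Otimes>\<^sub>M std_normal))"
    unfolding F by (rule nn_integral_std_normal_polar[symmetric]) simp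
  finally show ?thesis .
qed

lemma AE_std_normal_pair_line:
  assumes "d \<noteq> 0"
  shows "AE (x, y) in std_normal \<Otimes>\<^sub>M std_normal. x \<noteq> 0 \<and> c * x + d * y \<noteq> 0"
proof -
  interpret N: prob_space std_normal by (rule prob_space_std_normal)
  interpret P: pair_sigma_finite std_normal std_normal ..
  have ne: "AE x in std_normal. x \<noteq> v" for v
    by (subst AE_density) (use AE_lborel_singleton[of v] in auto)
  have "AE y in std_normal. c * x + d * y \<noteq> 0" for x
    using ne[of "- (c * x / d)"] by eventually_elim (use assms in \<open>auto simp: field_simps\<close>)
  then have "AE x in std_normal. AE y in std_normal. x \<noteq> 0 \<and> c * x + d * y \<noteq> 0"
    using ne[of 0] by auto
  moreover have "{z \<in> space (std_normal \<Otimes>\<^sub>M std_normal). case z of (x, y) \<Rightarrow> x \<noteq> 0 \<and> c * x + d * y \<noteq> 0}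
      \<in> sets (std_normal \<Otimes>\<^sub>M std_normal)"
    by measurable
  ultimately show ?thesis
    by (intro P.AE_pair_measure) auto
qed

section \<open>The law of \<open>W\<close> for a lower triangular factor\<close>

lemma measurable_W_monomial [measurable]: "W_monomial \<alpha> S \<in> borel_measurable borel"
  unfolding W_monomial_def by measurable

lemma W_monomial_2:
  fixes \<alpha> :: "real ^ 2"
  shows "W_monomial \<alpha> S (vector [u, v]) = inverse (S $ 1 $ 1 * (\<alpha> $ 1)\<^sup>2 / u\<^sup>2 +
    (S $ 1 $ 2 + S $ 2 $ 1) * (\<alpha> $ 1 * \<alpha> $ 2) / (u * v) + S $ 2 $ 2 * (\<alpha> $ 2)\<^sup>2 / v\<^sup>2)"
  unfolding W_monomial_def sum_2 vector_2
  by (simp add: power2_eq_square distrib_right add_divide_distrib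
      mult.commute[of v u] mult.commute[of "\<alpha> $ 2" "\<alpha> $ 1"])

text \<open>
  If \<open>S\<close> has rank one, the normal vector is a multiple \<open>(s x, c x)\<close> of a fixed one. At \<open>x = 0\<close> both sides
  are zero, because division by zero and the inverse of zero give zero.
\<close>

lemma W_monomial_singular:
  fixes \<alpha> :: "real ^ 2"
  assumes S: "S $ 1 $ 1 = s\<^sup>2" "S $ 1 $ 2 = s * c" "S $ 2 $ 1 = s * c" "S $ 2 $ 2 = c\<^sup>2"
    and "s \<noteq> 0" "c \<noteq> 0"
  shows "W_monomial \<alpha> S (vector [s * x, c * x]) = x\<^sup>2 / (\<alpha> $ 1 + \<alpha> $ 2)\<^sup>2"
proof (cases "x = 0")
  case False
  have "W_monomial \<alpha> S (vector [s * x, c * x]) = inverse ((\<alpha> $ 1 + \<alpha> $ 2)\<^sup>2 / x\<^sup>2)"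
    unfolding W_monomial_2 S using assms False
    by (intro arg_cong[where f = inverse]) (simp add: field_simps power2_eq_square)
  then show ?thesis by simp
qed (simp add: W_monomial_2)

text \<open>
  With \<open>v = t + b\<close>, the claim reduces to the polynomial identity
  \<open>(\<alpha>\<^sub>1\<^sup>2 v\<^sup>2 + 2 b \<alpha>\<^sub>1 \<alpha>\<^sub>2 v + (1 + b\<^sup>2) \<alpha>\<^sub>2\<^sup>2) (1 + t\<^sup>2) = (a v)\<^sup>2 + (\<alpha>\<^sub>1 t v + \<alpha>\<^sub>2 (b t - 1))\<^sup>2\<close>.
\<close>

lemma W_monomial_regular:
  fixes \<alpha> :: "real ^ 2"
  assumes S: "S $ 1 $ 1 = s\<^sup>2" "S $ 1 $ 2 = s * c" "S $ 2 $ 1 = s * c" "S $ 2 $ 2 = c\<^sup>2 + d\<^sup>2"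
    and nz: "s \<noteq> 0" "d \<noteq> 0" "x \<noteq> 0" "c * x + d * y \<noteq> 0"
    and a: "a = \<alpha> $ 1 + \<alpha> $ 2" "0 < a" and b: "b = c / d" and t: "t = y / x"
  shows "W_monomial \<alpha> S (vector [s * x, c * x + d * y]) =
    (x\<^sup>2 + y\<^sup>2) / (a\<^sup>2 * (1 + (\<alpha> $ 1 / a * t + \<alpha> $ 2 / a * (b * t - 1) / (t + b))\<^sup>2))"
proof -
  define v where "v = t + b"
  define F where "F = \<alpha> $ 1 / a * t + \<alpha> $ 2 / a * (b * t - 1) / (t + b)"
  have y: "y = x * t" and c: "c = d * b" using nz by (simp_all add: t b)
  have u: "c * x + d * y = x * d * v" by (simp add: y c v_def algebra_simps)
  with nz have v: "v \<noteq> 0" by auto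
  have pos: "0 < 1 + t\<^sup>2" by (simp add: add_pos_nonneg)
  have aF: "a * F = (\<alpha> $ 1 * t * v + \<alpha> $ 2 * (b * t - 1)) / v"
    using a(2) v unfolding F_def v_def[symmetric] by (simp add: field_simps)
  define B where "B = (\<alpha> $ 1)\<^sup>2 + 2 * b * \<alpha> $ 1 * \<alpha> $ 2 / v + (1 + b\<^sup>2) * (\<alpha> $ 2)\<^sup>2 / v\<^sup>2"
  have "B * v\<^sup>2 * (1 + t\<^sup>2) = ((\<alpha> $ 1)\<^sup>2 * v\<^sup>2 + 2 * b * \<alpha> $ 1 * \<alpha> $ 2 * v + (1 + b\<^sup>2) * (\<alpha> $ 2)\<^sup>2) * (1 + t\<^sup>2)"
    using v by (simp add: B_def field_simps power2_eq_square)
  also have "\<dots> = (a * v)\<^sup>2 + (\<alpha> $ 1 * t * v + \<alpha> $ 2 * (b * t - 1))\<^sup>2"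
    unfolding a v_def by algebra
  also have "\<dots> = a\<^sup>2 * (1 + F\<^sup>2) * v\<^sup>2"
  proof -
    have "\<alpha> $ 1 * t * v + \<alpha> $ 2 * (b * t - 1) = a * F * v" using aF v by simp
    then show ?thesis by (simp only: power_mult_distrib distrib_left distrib_right mult_1_right)
  qed
  finally have B: "B * (1 + t\<^sup>2) = a\<^sup>2 * (1 + F\<^sup>2)" using v by simp
  have "W_monomial \<alpha> S (vector [s * x, c * x + d * y]) = inverse (B / x\<^sup>2)"
    unfolding W_monomial_2 S u using nz v
    by (intro arg_cong[where f = inverse]) (simp add: B_def c field_simps power2_eq_square)
  also have "\<dots> = x\<^sup>2 * (1 + t\<^sup>2) / (B * (1 + t\<^sup>2))"
    using pos by simp
  also have "x\<^sup>2 * (1 + t\<^sup>2) = x\<^sup>2 + y\<^sup>2" by (simp add: y power_mult_distrib distrib_left)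
  finally show ?thesis by (simp add: B F_def)
qed

lemma distr_W_monomial_cholesky:
  fixes \<alpha> :: "real ^ 2"
  assumes S: "S $ 1 $ 1 = s\<^sup>2" "S $ 1 $ 2 = s * c" "S $ 2 $ 1 = s * c" "S $ 2 $ 2 = c\<^sup>2 + d\<^sup>2"
    and pos: "s \<noteq> 0" "0 < S $ 2 $ 2" "\<And>i. 0 < \<alpha> $ i"
  shows "distr (std_normal \<Otimes>\<^sub>M std_normal) borel (\<lambda>(x, y). W_monomial \<alpha> S (vector [s * x, c * x + d * y])) =
    distr (std_normal \<Otimes>\<^sub>M std_normal) borel (\<lambda>(x, y). x\<^sup>2 / (\<alpha> $ 1 + \<alpha> $ 2)\<^sup>2)"
proof (cases "d = 0")
  case True
  with S pos(2) have "c \<noteq> 0" by auto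
  with True S pos(1) show ?thesis by (simp add: W_monomial_singular)
next
  case False
  define a b where "a = \<alpha> $ 1 + \<alpha> $ 2" and "b = c / d"
  define F where "F t = \<alpha> $ 1 / a * t + \<alpha> $ 2 / a * (b * t - 1) / (t + b)" for t
  have a: "0 < a" using pos(3) by (simp add: a_def add_pos_pos)
  have [measurable]: "F \<in> borel_measurable borel" unfolding F_def by measurable
  have F: "distr cauchy borel F = cauchy"
    unfolding F_def using pos(3) a
    by (intro distr_cauchy_inner) (auto simp: add_divide_distrib[symmetric] a_def)
  show ?thesis
  proof (rule measure_eqI)
    fix A assume "A \<in> sets (distr (std_normal \<Otimes>\<^sub>M std_normal) borel
      (\<lambda>(x, y). W_monomial \<alpha> S (vector [s * x, c * x + d * y])))"
    then have [measurable]: "A \<in> sets borel" by simp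
    define k :: "real \<times> real \<Rightarrow> ennreal" where "k = (\<lambda>(r, t). indicator A (r / (a\<^sup>2 * (1 + t\<^sup>2))))"
    have [measurable]: "k \<in> borel_measurable (borel \<Otimes>\<^sub>M borel)" unfolding k_def by measurable
    have emeasure: "emeasure (distr (std_normal \<Otimes>\<^sub>M std_normal) borel f) A =
        (\<integral>\<^sup>+z. indicator A (f z) \<partial>(std_normal \<Otimes>\<^sub>M std_normal))"
      if [measurable]: "f \<in> borel_measurable (std_normal \<Otimes>\<^sub>M std_normal)" for f :: "real \<times> real \<Rightarrow> real"
    proof -
      have "emeasure (distr (std_normal \<Otimes>\<^sub>M std_normal) borel f) A =
          (\<integral>\<^sup>+y. indicator A y \<partial>distr (std_normal \<Otimes>\<^sub>M std_normal) borel f)"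
        by simp
      also have "\<dots> = (\<integral>\<^sup>+z. indicator A (f z) \<partial>(std_normal \<Otimes>\<^sub>M std_normal))"
        by (rule nn_integral_distr) auto
      finally show ?thesis .
    qed
    \<comment> \<open>The closed form of \<open>W\<close> requires nonzero components, hence the null set of two lines left out.\<close>
    have "emeasure (distr (std_normal \<Otimes>\<^sub>M std_normal) borel
        (\<lambda>(x, y). W_monomial \<alpha> S (vector [s * x, c * x + d * y]))) A =
        (\<integral>\<^sup>+(x, y). k (x\<^sup>2 + y\<^sup>2, F (y / x)) \<partial>(std_normal \<Otimes>\<^sub>M std_normal))"
      by (subst emeasure, measurable, rule nn_integral_cong_AE)
        (use AE_std_normal_pair_line[OF False, of c] in eventually_elim,
          auto simp: k_def F_def W_monomial_regular[OF S pos(1) False _ _ a_def a b_def refl])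
    also have "\<dots> = (\<integral>\<^sup>+(x, y). k (x\<^sup>2 + y\<^sup>2, y / x) \<partial>(std_normal \<Otimes>\<^sub>M std_normal))"
      by (rule nn_integral_std_normal_cauchy_map) (simp_all add: F)
    also have "\<dots> = emeasure (distr (std_normal \<Otimes>\<^sub>M std_normal) borel (\<lambda>(x, y). x\<^sup>2 / a\<^sup>2)) A"
    proof -
      have "(x\<^sup>2 + y\<^sup>2) / (a\<^sup>2 * (1 + (y / x)\<^sup>2)) = x\<^sup>2 / a\<^sup>2" if "x \<noteq> 0" for x y
      proof -
        have "x\<^sup>2 + y\<^sup>2 = x\<^sup>2 * (1 + (y / x)\<^sup>2)" "1 + (y / x)\<^sup>2 \<noteq> 0"
          using that by (simp_all add: power_divide field_simps add_pos_nonneg)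
        then show ?thesis by simp
      qed
      then show ?thesis
        by (subst emeasure, measurable, intro nn_integral_cong_AE)
          (use AE_std_normal_pair_line[OF False, of c] in eventually_elim, auto simp: k_def)
    qed
    finally show "emeasure (distr (std_normal \<Otimes>\<^sub>M std_normal) borel
        (\<lambda>(x, y). W_monomial \<alpha> S (vector [s * x, c * x + d * y]))) A =
        emeasure (distr (std_normal \<Otimes>\<^sub>M std_normal) borel (\<lambda>(x, y). x\<^sup>2 / (\<alpha> $ 1 + \<alpha> $ 2)\<^sup>2)) A"
      by (simp add: a_def)
  qed simp
qed

section \<open>Passage to an arbitrary normal vector\<close>

lemma distr_chi_square_1:
  "distr (chi_square 1) borel (\<lambda>y. c * y) =
    distr (std_normal \<Otimes>\<^sub>M std_normal) borel (\<lambda>(x, y). c * x\<^sup>2)"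
proof -
  interpret N: prob_space std_normal by (rule prob_space_std_normal)
  let ?P = "\<Pi>\<^sub>M i\<in>{..<Suc 0}. std_normal"
  have [measurable]: "(\<lambda>z. z 0) \<in> measurable ?P borel"
    using measurable_component_singleton[of 0 "{..<Suc 0}" "\<lambda>_. std_normal"] by simp
  have "distr (chi_square 1) borel (\<lambda>y. c * y) = distr ?P borel (\<lambda>z. c * (z 0)\<^sup>2)"
    unfolding chi_square_def One_nat_def by (subst distr_distr) (auto simp: comp_def)
  also have "\<dots> = distr (distr ?P std_normal (\<lambda>z. z 0)) borel (\<lambda>x. c * x\<^sup>2)"
    by (subst distr_distr) (auto simp: comp_def)
  also have "distr ?P std_normal (\<lambda>z. z 0) = std_normal"
    by (intro distr_PiM_component) (auto intro: prob_space_std_normal)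
  also have "\<dots> = distr (std_normal \<Otimes>\<^sub>M std_normal) std_normal fst"
    by (rule N.distr_pair_fst[symmetric])
  also have "distr \<dots> borel (\<lambda>x. c * x\<^sup>2) = distr (std_normal \<Otimes>\<^sub>M std_normal) borel (\<lambda>(x, y). c * x\<^sup>2)"
    by (subst distr_distr) (auto simp: comp_def case_prod_unfold)
  finally show ?thesis .
qed

text \<open>
  The factor \<open>A\<close> in the definition of a normal law is brought to lower triangular form by a rotation
  of the standard normal vector.
\<close>

lemma multivariate_normal_2_cholesky:
  fixes S :: "real ^ 2 ^ 2"
  assumes "multivariate_normal N 0 S" and "0 < S $ 1 $ 1"
  obtains s c d where "S $ 1 $ 1 = s\<^sup>2" "S $ 1 $ 2 = s * c" "S $ 2 $ 1 = s * c" "S $ 2 $ 2 = c\<^sup>2 + d\<^sup>2"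
    and "s \<noteq> 0"
    and "N = distr (std_normal \<Otimes>\<^sub>M std_normal) borel (\<lambda>(x, y). vector [s * x, c * x + d * y])"
proof -
  obtain A :: "real ^ 2 ^ 2" where A: "A ** transpose A = S"
    and N: "N = distr std_normal_vec borel (\<lambda>z. A *v z)"
    using assms(1) by (auto simp: multivariate_normal_def)
  \<comment> \<open>The first row of \<open>A\<close> is \<open>s\<close> times the unit vector \<open>(e, f)\<close>; the rotation \<open>Q\<close> sends \<open>(e, f)\<close> to \<open>(1, 0)\<close>.\<close>
  define s where "s = sqrt ((A $ 1 $ 1)\<^sup>2 + (A $ 1 $ 2)\<^sup>2)"
  define e f where "e = A $ 1 $ 1 / s" and "f = A $ 1 $ 2 / s"
  define c d where "c = A $ 2 $ 1 * e + A $ 2 $ 2 * f" and "d = A $ 2 $ 2 * e - A $ 2 $ 1 * f"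
  have S: "S $ i $ j = A $ i $ 1 * A $ j $ 1 + A $ i $ 2 * A $ j $ 2" for i j
    by (simp add: A[symmetric] matrix_matrix_mult_def transpose_def sum_2)
  have s2: "S $ 1 $ 1 = s\<^sup>2"
    by (simp add: S s_def power2_eq_square)
  with assms(2) have s: "s \<noteq> 0" by auto
  then have A1: "A $ 1 $ 1 = s * e" "A $ 1 $ 2 = s * f" by (simp_all add: e_def f_def)
  have "s\<^sup>2 * (e\<^sup>2 + f\<^sup>2) = s\<^sup>2 * 1"
    using S[of 1 1] s2 by (simp add: A1 power2_eq_square algebra_simps)
  then have ef: "e\<^sup>2 + f\<^sup>2 = 1" using s by simp
  have A2: "A $ 2 $ 1 = c * e - d * f" "A $ 2 $ 2 = c * f + d * e"
    unfolding c_def d_def using ef by algebra+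
  define Q :: "real ^ 2 \<Rightarrow> real ^ 2" where "Q z = vector [e * z $ 1 + f * z $ 2, e * z $ 2 - f * z $ 1]" for z
  have Q: "orthogonal_transformation Q"
    unfolding orthogonal_transformation_def
  proof (intro conjI allI)
    show "linear Q"
      by (intro linearI) (auto simp: Q_def vec_eq_iff forall_2 algebra_simps)
    fix v w
    have "Q v \<bullet> Q w = (e\<^sup>2 + f\<^sup>2) * (v \<bullet> w)"
      by (simp add: Q_def inner_vec_def sum_2 power2_eq_square algebra_simps)
    then show "Q v \<bullet> Q w = v \<bullet> w" by (simp add: ef)
  qed
  let ?L = "\<lambda>z :: real ^ 2. vector [s * z $ 1, c * z $ 1 + d * z $ 2] :: real ^ 2"
  have AQ: "A *v z = ?L (Q z)" for z
    by (simp add: vec_eq_iff forall_2 Q_def matrix_vector_mult_def sum_2 A1 A2 algebra_simps)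
  have [measurable]: "Q \<in> borel_measurable borel" unfolding Q_def by measurable
  have [measurable_cong]: "sets (std_normal_vec :: (real ^ 2) measure) = sets borel"
    by (simp add: std_normal_vec_def)
  have "N = distr (distr std_normal_vec borel Q) borel ?L"
    unfolding N AQ by (subst distr_distr) (auto simp: comp_def)
  also have "\<dots> = distr std_normal_vec borel ?L"
    by (simp only: std_normal_vec_orthogonal_transformation[OF Q])
  also have "\<dots> = distr (std_normal \<Otimes>\<^sub>M std_normal) borel (\<lambda>(x, y). vector [s * x, c * x + d * y])"
    unfolding std_normal_vec_2 by (subst distr_distr) (auto simp: comp_def case_prod_unfold)
  finally have "N = distr (std_normal \<Otimes>\<^sub>M std_normal) borel (\<lambda>(x, y). vector [s * x, c * x + d * y])" .
  moreover have "S $ 1 $ 2 = s * c" "S $ 2 $ 1 = s * c" "S $ 2 $ 2 = c\<^sup>2 + d\<^sup>2"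
    unfolding S A1 A2 using ef by algebra+
  ultimately show thesis using that s2 s by blast
qed

theorem theorem5p1:
  fixes M :: "'a measure" and X :: "'a \<Rightarrow> real ^ 2"
    and \<alpha> :: "real ^ 2" and S :: "real ^ 2 ^ 2"
  assumes "prob_space M"
    and "positive_semidefinite S"
    and "\<And>i. 0 < S $ i $ i"
    and "\<And>i. 0 < \<alpha> $ i"
    and "X \<in> borel_measurable M"
    and "multivariate_normal (distr M borel X) 0 S"
  shows "distr M borel (\<lambda>\<omega>. W_monomial \<alpha> S (X \<omega>)) =
    distr (chi_square 1) borel (\<lambda>y. 1 / (\<alpha> $ 1 + \<alpha> $ 2)\<^sup>2 * y)"
proof -
  note [measurable] = assms(5)
  obtain s c d where S: "S $ 1 $ 1 = s\<^sup>2" "S $ 1 $ 2 = s * c" "S $ 2 $ 1 = s * c" "S $ 2 $ 2 = c\<^sup>2 + d\<^sup>2"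
    and s: "s \<noteq> 0"
    and X: "distr M borel X = distr (std_normal \<Otimes>\<^sub>M std_normal) borel (\<lambda>(x, y). vector [s * x, c * x + d * y])"
    by (rule multivariate_normal_2_cholesky[OF assms(6) assms(3)[of 1]])
  have "distr M borel (\<lambda>\<omega>. W_monomial \<alpha> S (X \<omega>)) = distr (distr M borel X) borel (W_monomial \<alpha> S)"
    by (subst distr_distr) (auto simp: comp_def)
  also have "\<dots> = distr (std_normal \<Otimes>\<^sub>M std_normal) borel
      (\<lambda>(x, y). W_monomial \<alpha> S (vector [s * x, c * x + d * y]))"
    unfolding X by (subst distr_distr) (auto simp: comp_def case_prod_unfold)
  also have "\<dots> = distr (std_normal \<Otimes>\<^sub>M std_normal) borel (\<lambda>(x, y). x\<^sup>2 / (\<alpha> $ 1 + \<alpha> $ 2)\<^sup>2)"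
    by (rule distr_W_monomial_cholesky[OF S s assms(3,4)])
  also have "\<dots> = distr (chi_square 1) borel (\<lambda>y. 1 / (\<alpha> $ 1 + \<alpha> $ 2)\<^sup>2 * y)"
    unfolding distr_chi_square_1 by (simp only: times_divide_eq_left mult_1_left)
  finally show ?thesis .
qed

end
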